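(* Let $q=2^t$ for a positive integer $t$. If $\mathcal{F}$ is a triangular subfamily of maximum size of the family $\mathbb{P}(q)$ of lines of the projective plane of order $q$ over $\mathbb{F}_q$, then $|\mathcal{F}|=q+2$.
   Context: Let $\mathbb{F}_q$ be the finite field of order $q$, let $\omega$ be a symbol not in $\mathbb{F}_q$, and let $V=((\mathbb{F}_q\cup\{\omega\})\times\mathbb{F}_q)\cup\{(\omega,\omega)\}$ be the set of points, $|V|=q^2+q+1$. The projective plane $\mathbb{P}(q)$ is viewed as the family of its lines $\{L_\alpha\mid\alpha\in V\}$, each a set of points, where - $L_{(m,b)}=\{(x,y)\in\mathbb{F}_q\times\mathbb{F}_q\mid y=mx+b\}\cup\{(\omega,m)\}$ for $(m,b)\in\mathbb{F}_q\times\mathbb{F}_q$; - $L_{(\omega,b)}=\{(b,y)\mid y\in\mathbb{F}_q\}\cup\{(\omega,\omega)\}$ for $b\in\mathbb{F}_q$; - $L_{(\omega,\omega)}=\{(\omega,y)\mid y\in\mathbb{F}_q\}\cup\{(\omega,\omega)\}$. A family $\mathcal{F}$ of sets is triangular if $A\cap B\cap C=\emptyset$ for every three distinct members $A,B,C\in\mathcal{F}$. *)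

theory Defs
  imports "HOL-Library.Cardinality"
begin

text \<open>
  The finite field is a type \<open>'a :: {field, finite}\<close>, and \<open>'a option\<close> is the field with the
  extra symbol \<open>\<omega>\<close> adjoined: \<open>None\<close> is \<open>\<omega>\<close>, and \<open>Some\<close> embeds the field.
\<close>

abbreviation (input) omega :: "'a option" ("\<omega>")
  where "\<omega> \<equiv> None"

text \<open>The pairs \<open>(Some m, \<omega>)\<close> are neither points nor line indices.\<close>

definition pg_points :: "('a::{field,finite} option \<times> 'a option) set" where
  "pg_points = (insert \<omega> (range Some) \<times> range Some) \<union> {(\<omega>, \<omega>)}"

fun pg_line ::
  "'a::{field,finite} option \<times> 'a option \<Rightarrow> ('a option \<times> 'a option) set" where
  "pg_line (Some m, Some b) = {(Some x, Some y) |x y. y = m * x + b} \<union> {(\<omega>, Some m)}"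
| "pg_line (\<omega>, Some b) = {(Some b, Some y) |y. True} \<union> {(\<omega>, \<omega>)}"
| "pg_line (\<omega>, \<omega>) = {(\<omega>, Some y) |y. True} \<union> {(\<omega>, \<omega>)}"
| "pg_line (Some m, \<omega>) = undefined"

definition proj_plane :: "('a::{field,finite} option \<times> 'a option) set set" where
  "proj_plane = pg_line ` pg_points"

definition triangular :: "'p set set \<Rightarrow> bool" where
  "triangular \<F> \<longleftrightarrow>
     (\<forall>A\<in>\<F>. \<forall>B\<in>\<F>. \<forall>C\<in>\<F>. A \<noteq> B \<and> A \<noteq> C \<and> B \<noteq> C \<longrightarrow> A \<inter> B \<inter> C = {})"

end

theory Submission
  imports Defs
begin

text \<open>
  In a triangular family of lines, distinct members other than a fixed line \<open>A\<close> meet \<open>A\<close> in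
  distinct points, so the family has at most \<open>|A| + 1 = q + 2\<close> members. In characteristic \<open>2\<close> a
  dual hyperoval attains the bound: the \<open>q\<close> lines \<open>y = m x + m\<^sup>2\<close>, the line at infinity, and the
  line \<open>x = 0\<close>. Indeed \<open>m\<^sup>2 + x m = y\<close> has at most two solutions \<open>m\<close>, and only one if \<open>x = 0\<close>,
  since squaring is injective.
\<close>

lemma triangular_card_le:
  assumes "triangular \<F>" "A \<in> \<F>" "finite A"
    and meet: "\<And>B. B \<in> \<F> \<Longrightarrow> A \<inter> B \<noteq> {}"
  shows "card \<F> \<le> Suc (card A)"
proof (cases "finite \<F>")
  case True
  have "\<forall>B\<in>\<F>. \<exists>p. p \<in> A \<inter> B" using meet by blast
  then obtain f where f: "\<And>B. B \<in> \<F> \<Longrightarrow> f B \<in> A \<inter> B" by metis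
  have "inj_on f (\<F> - {A})"
  proof (rule inj_onI, rule ccontr)
    fix B C
    assume BC: "B \<in> \<F> - {A}" "C \<in> \<F> - {A}" "f B = f C" "B \<noteq> C"
    then have "f B \<in> A \<inter> B \<inter> C" using f[of B] f[of C] by auto
    with BC assms(1,2) show False unfolding triangular_def by blast
  qed
  moreover have "f ` (\<F> - {A}) \<subseteq> A" using f by auto
  ultimately have "card (\<F> - {A}) \<le> card A"
    using \<open>finite A\<close> by (rule card_inj_on_le)
  with True \<open>A \<in> \<F>\<close> show ?thesis by (metis card_Suc_Diff1 Suc_le_mono)
\<comment> \<open>An infinite family has \<open>card\<close> 0.\<close>
qed simp

text \<open>This incidence table replaces the defining equations as simp rules, so that lines stay
  folded and each incidence becomes an equation or a truth value.\<close>

lemma mem_pg_line_simps [simp]: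
  "(Some x, Some y) \<in> pg_line (Some m, Some b) \<longleftrightarrow> y = m * x + b"
  "(None, Some y) \<in> pg_line (Some m, Some b) \<longleftrightarrow> y = m"
  "(u, None) \<notin> pg_line (Some m, Some b)"
  "(Some x, Some y) \<in> pg_line (None, Some b) \<longleftrightarrow> x = b"
  "(None, Some y) \<notin> pg_line (None, Some b)"
  "(u, None) \<in> pg_line (None, Some b) \<longleftrightarrow> u = None"
  "(Some x, v) \<notin> pg_line (None, None)"
  "(None, v) \<in> pg_line (None, None)"
  by auto

declare pg_line.simps [simp del]

text \<open>The index \<open>(Some m, None)\<close>, where \<open>pg_line\<close> is
  \<open>undefined\<close>, is not in \<open>pg_points\<close>, so no fourth case arises.\<close>

lemma proj_plane_cases:
  assumes "L \<in> proj_plane"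
  obtains m b where "L = pg_line (Some m, Some b)"
  | b where "L = pg_line (None, Some b)"
  | "L = pg_line (None, None)"
  using assms unfolding proj_plane_def pg_points_def by blast

lemma card_proj_plane_line:
  fixes L :: "('a::{field,finite} option \<times> 'a option) set"
  assumes "L \<in> proj_plane"
  shows "card L = Suc CARD('a)"
  using assms
proof (cases rule: proj_plane_cases)
  case (1 m b)
  have "L = insert (None, Some m) (range (\<lambda>x. (Some x, Some (m * x + b))))"
    unfolding 1 by (auto simp: pg_line.simps)
  then show ?thesis by (auto simp: card_insert_if card_image inj_on_def)
next
  case (2 b)
  have "L = insert (None, None) (range (\<lambda>y. (Some b, Some y)))"
    unfolding 2 by (auto simp: pg_line.simps)
  then show ?thesis by (auto simp: card_insert_if card_image inj_on_def)
next
  case 3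
  have "L = insert (None, None) (range (\<lambda>y. (None, Some y)))"
    unfolding 3 by (auto simp: pg_line.simps)
  then show ?thesis by (auto simp: card_insert_if card_image inj_on_def)
qed

text \<open>The case \<open>A = B\<close> is included because \<open>meet\<close> in
  \<open>triangular_card_le\<close> ranges over \<open>A\<close> as well.\<close>

lemma proj_plane_lines_meet:
  assumes "A \<in> proj_plane" "B \<in> proj_plane"
  shows "(A :: ('a::{field,finite} option \<times> 'a option) set) \<inter> B \<noteq> {}"
proof -
  have affine: "pg_line (Some m, Some b) \<inter> pg_line (Some n, Some c) \<noteq> {}" for m b n c :: 'a
  proof (cases "m = n")
    case True
    then have "(None, Some m) \<in> pg_line (Some m, Some b) \<inter> pg_line (Some n, Some c)" by simp
    then show ?thesis by blast
  next
    case False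
    \<comment> \<open>The abscissa solving \<open>m * x + b = n * x + c\<close>.\<close>
    define x where "x = (c - b) / (m - n)"
    have "(m - n) * x = c - b" using False by (simp add: x_def)
    then have "m * x + b = n * x + c" by (simp add: algebra_simps)
    then have "(Some x, Some (m * x + b)) \<in> pg_line (Some m, Some b) \<inter> pg_line (Some n, Some c)"
      by simp
    then show ?thesis by blast
  qed
  have "(Some c, Some (m * c + b)) \<in> pg_line (Some m, Some b) \<inter> pg_line (None, Some c)"
    and "(None, Some m) \<in> pg_line (Some m, Some b) \<inter> pg_line (None, None)"
    and "(None, None) \<in> pg_line (None, Some b) \<inter> pg_line (None, Some c)"
    and "(None, None) \<in> pg_line (None, Some b) \<inter> pg_line (None, None)"
    and "(None, None) \<in> pg_line (None, None) \<inter> pg_line (None, None)"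
    for m b c :: 'a
    by simp_all
  then have others:
    "pg_line (Some m, Some b) \<inter> pg_line (None, Some c) \<noteq> {}"
    "pg_line (Some m, Some b) \<inter> pg_line (None, None) \<noteq> {}"
    "pg_line (None, Some b) \<inter> pg_line (None, Some c) \<noteq> {}"
    "pg_line (None, Some b) \<inter> pg_line (None, None) \<noteq> {}"
    "pg_line (None, None) \<inter> pg_line (None, None) \<noteq> {}"
    for m b c :: 'a
    by (metis empty_iff)+
  show ?thesis
    using assms
    by (elim proj_plane_cases; simp only:) (metis affine others Int_commute)+
qed

text \<open>Translation by 1 permutes the field, so it preserves the sum of all elements while
  adding \<open>CARD('a)\<close> to it. Hence \<open>2 ^ t\<close> vanishes in the field, and so
  does 2.\<close>

lemma two_eq_zero_if_card_power_of_two: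
  assumes "CARD('a::{field,finite}) = 2 ^ t"
  shows "(2::'a) = 0"
proof -
  have "(\<Sum>x\<in>UNIV. x + 1) = (\<Sum>x\<in>UNIV. x :: 'a)"
    by (rule sum.reindex_bij_witness[of _ "\<lambda>x. x - 1" "\<lambda>x. x + 1"]) auto
  then have "of_nat CARD('a) = (0::'a)" by (simp add: sum.distrib)
  with assms show ?thesis by simp
qed

text \<open>In dual coordinates the first line and the range form a conic; in characteristic 2 the
  line \<open>x = 0\<close> is its nucleus.\<close>

definition dual_hyperoval :: "('a::{field,finite} option \<times> 'a option) set set" where
  "dual_hyperoval =
     insert (pg_line (None, None)) (insert (pg_line (None, Some 0))
       (range (\<lambda>m. pg_line (Some m, Some (m\<^sup>2)))))"

lemma dual_hyperoval_subset: "dual_hyperoval \<subseteq> proj_plane"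
  unfolding dual_hyperoval_def proj_plane_def pg_points_def by blast

text \<open>The slope is recovered from the point at infinity of an affine line, so the
  \<open>q\<close> lines in the range are distinct.\<close>

lemma card_dual_hyperoval:
  "card (dual_hyperoval :: ('a::{field,finite} option \<times> 'a option) set set) = CARD('a) + 2"
proof -
  have inj: "inj (\<lambda>m::'a. pg_line (Some m, Some (m\<^sup>2)))"
    by (rule injI) (metis mem_pg_line_simps(2))
  have "pg_line (None, None) \<noteq> pg_line (Some m, Some b)"
    "pg_line (None, Some c) \<noteq> pg_line (Some m, Some b)"
    "pg_line (None, None) \<noteq> pg_line (None, Some c)" for m b c :: 'a
    by (metis mem_pg_line_simps)+
  then show ?thesis
    unfolding dual_hyperoval_def by (auto simp: card_insert_if card_image[OF inj])
qed

text \<open>The case analysis on a point shows that at most two members pass through it.\<close>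

lemma triangular_dual_hyperoval:
  assumes two: "(2::'a::{field,finite}) = 0"
  shows "triangular (dual_hyperoval :: ('a option \<times> 'a option) set set)"
proof -
  have neg: "- x = x" for x :: 'a
    using two by (metis add_eq_0_iff mult_2 mult_zero_left)
  have slopes: "m + n = x" if "m * x + m\<^sup>2 = n * x + n\<^sup>2" "m \<noteq> n" for m n x :: 'a
  proof -
    \<comment> \<open>The difference of the two equations factors.\<close>
    have "(m - n) * (m + n + x) = 0"
      using that(1) by (simp add: algebra_simps power2_eq_square)
    with that(2) have "m + n = - x" by (simp add: eq_neg_iff_add_eq_0)
    then show ?thesis by (simp add: neg)
  qed
  show ?thesis
    unfolding triangular_def
  proof (intro ballI impI, rule ccontr)
    fix A B C :: "('a option \<times> 'a option) set"
    assume F: "A \<in> dual_hyperoval" "B \<in> dual_hyperoval" "C \<in> dual_hyperoval"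
      and neq: "A \<noteq> B \<and> A \<noteq> C \<and> B \<noteq> C"
      and "A \<inter> B \<inter> C \<noteq> {}"
    then obtain u v where p: "(u, v) \<in> A" "(u, v) \<in> B" "(u, v) \<in> C" by auto
    have lines: "L = pg_line (None, None) \<or> L = pg_line (None, Some 0)
        \<or> (\<exists>m. L = pg_line (Some m, Some (m\<^sup>2)))" if "L \<in> dual_hyperoval"
      for L :: "('a option \<times> 'a option) set"
      using that unfolding dual_hyperoval_def by auto
    show False
    proof (cases u; cases v)
      assume uv: "u = None" "v = None"
      have "L = pg_line (None, None) \<or> L = pg_line (None, Some 0)"
        if "L \<in> dual_hyperoval" "(u, v) \<in> L" for L
        using lines[OF that(1)] that(2) uv by auto
      then show False using F p neq by metis
    next
      fix y assume uv: "u = None" "v = Some y"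
      have "L = pg_line (None, None) \<or> L = pg_line (Some y, Some (y\<^sup>2))"
        if "L \<in> dual_hyperoval" "(u, v) \<in> L" for L
        using lines[OF that(1)] that(2) uv by auto
      then show False using F p neq by metis
    next
      \<comment> \<open>Such a pair is not a point of the plane and lies on no member.\<close>
      fix x assume uv: "u = Some x" "v = None"
      show False using lines[OF F(1)] p(1) uv by auto
    next
      fix x y assume uv: "u = Some x" "v = Some y"
      have cases: "L = pg_line (None, Some 0) \<and> x = 0
          \<or> (\<exists>m. L = pg_line (Some m, Some (m\<^sup>2)) \<and> y = m * x + m\<^sup>2)"
        if "L \<in> dual_hyperoval" "(u, v) \<in> L" for L
        using lines[OF that(1)] that(2) uv by auto
      have "\<exists>L1 L2. \<forall>L. L \<in> dual_hyperoval \<and> (u, v) \<in> L \<longrightarrow> L = L1 \<or> L = L2"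
      proof (cases "\<exists>m. y = m * x + m\<^sup>2")
        case True
        then obtain m where m: "y = m * x + m\<^sup>2" by blast
        have root: "n = m \<or> n = x - m" if "y = n * x + n\<^sup>2" for n
          using slopes[of n x m] m that by (auto simp: eq_diff_eq)
        show ?thesis
        proof (cases "x = 0")
          \<comment> \<open>The second root \<open>x - m\<close> is now \<open>- m = m\<close>, so a
            single slope remains beside the line \<open>x = 0\<close>.\<close>
          case True
          then have "n = m" if "y = n * x + n\<^sup>2" for n
            using root[OF that] by (simp add: neg)
          with cases show ?thesis by metis
        next
          \<comment> \<open>The line \<open>x = 0\<close> misses the point, which leaves the slopes
            \<open>m\<close> and \<open>x - m\<close>.\<close>
          case False
          with cases root show ?thesis by metis
        qed
      next
        \<comment> \<open>Only the line \<open>x = 0\<close> can pass through the point, so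
          \<open>L1\<close> and \<open>L2\<close> may coincide.\<close>
        case False
        with cases show ?thesis by metis
      qed
      then show False using F p neq by metis
    qed
  qed
qed

theorem theorem24:
  fixes q t :: nat
    and \<F> :: "('a::{field,finite} option \<times> 'a option) set set"
  assumes "t > 0"
    and "q = 2 ^ t"
    and "CARD('a) = q"
    and "\<F> \<subseteq> proj_plane"
    and "triangular \<F>"
    and "\<And>\<G>. \<G> \<subseteq> (proj_plane :: ('a option \<times> 'a option) set set) \<Longrightarrow> triangular \<G> \<Longrightarrow>
           card \<G> \<le> card \<F>"
  shows "card \<F> = q + 2"
proof (rule antisym)
  show "card \<F> \<le> q + 2"
  proof (cases "\<F> = {}")
    \<comment> \<open>The counting bound needs some member \<open>A\<close> to count on.\<close>
    case False
    then obtain A where A: "A \<in> \<F>" by blast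
    have "card \<F> \<le> Suc (card A)"
      using assms(4,5) A by (intro triangular_card_le) (auto dest: proj_plane_lines_meet)
    also have "card A = Suc q"
      using card_proj_plane_line A assms(3,4) by blast
    finally show ?thesis by simp
  qed simp
  have "(2::'a) = 0"
    using assms(2,3) by (intro two_eq_zero_if_card_power_of_two) simp
  \<comment> \<open>Maximality of the family is applied to the dual hyperoval.\<close>
  then have "card (dual_hyperoval :: ('a option \<times> 'a option) set set) \<le> card \<F>"
    by (intro assms(6) dual_hyperoval_subset triangular_dual_hyperoval)
  then show "q + 2 \<le> card \<F>"
    using assms(3) by (simp add: card_dual_hyperoval)
qed

end
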